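(* Let $m\ge4$ be an even integer and $n=\frac{3^m-1}{4}$. Let $\beta$ be a primitive $2n$-th root of unity in an extension field of $\mathrm{GF}(3)$ and let $\mathbb{M}_{\beta^i}(x)$ denote the minimal polynomial of $\beta^i$ over $\mathrm{GF}(3)$. Let $\mathcal{C}(m)$ be the ternary negacyclic code of length $n$ with check polynomial $\mathrm{lcm}(\mathbb{M}_\beta(x),\mathbb{M}_{\beta^{2n-1}}(x))$. Then $\mathcal{C}(m)$ has parameters $[n,2m,d]$ with $d\ge\frac{3^{m-1}+1}{4}$, and $\mathcal{C}(m)^\perp$ has parameters $[n,n-2m,d^\perp]$ with $5\le d^\perp\le 6$; moreover $d^\perp=5$ if $m\equiv0\pmod 4$.
   Context: A ternary negacyclic code of length $n$ is an ideal of $\mathrm{GF}(3)[x]/(x^n+1)$; a code with check polynomial $h(x)$ (a monic divisor of $x^n+1$) is the one with generator polynomial $(x^n+1)/h(x)$. $[n,k,d]$ denotes length, dimension, minimum Hamming distance; $\perp$ is the Euclidean dual. *)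

theory Defs
  imports "Berlekamp_Zassenhaus.Finite_Field" "HOL-Computational_Algebra.Polynomial"
begin

typedef three = "{0::nat..<3}" by (rule exI[of _ 0]) simp

lemma card_three: "CARD(three) = 3"
  using type_definition.card[OF type_definition_three] by simp

instance three :: finite
proof
  show "finite (UNIV :: three set)"
    using type_definition.Abs_image[OF type_definition_three]
    by (metis finite_atLeastLessThan finite_imageI)
qed

instance three :: prime_card
  by standard (simp add: card_three)

type_synonym gf3 = "three mod_ring"

definition emb3 :: "gf3 \<Rightarrow> 'b::field" where
  "emb3 a = of_int (to_int_mod_ring a)"

definition min_poly3 :: "'b::field \<Rightarrow> gf3 poly" where
  "min_poly3 b = (THE p. monic p \<and> poly (map_poly emb3 p) b = 0 \<and>
       (\<forall>q. poly (map_poly emb3 q) b = 0 \<longrightarrow> p dvd q))"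

definition primitive_root_of_unity :: "nat \<Rightarrow> 'b::field \<Rightarrow> bool" where
  "primitive_root_of_unity N b \<longleftrightarrow> b ^ N = 1 \<and> (\<forall>k. 0 < k \<and> k < N \<longrightarrow> b ^ k \<noteq> 1)"

text \<open>Words of length n are identified with polynomials of degree < n
  (coefficient i = i-th coordinate); the ambient ring is GF(3)[x]/(x^n+1).\<close>
definition words :: "nat \<Rightarrow> 'a::field poly set" where
  "words n = {c. degree c < n}"

definition negacyclic_mod :: "nat \<Rightarrow> 'a::field poly" where
  "negacyclic_mod n = monom 1 n + 1"

definition negacyclic_code_check :: "nat \<Rightarrow> 'a::field poly \<Rightarrow> 'a poly set" where
  "negacyclic_code_check n h =
     {(negacyclic_mod n div h * f) mod negacyclic_mod n | f. True}"

definition hamming_dist :: "'a::zero poly \<Rightarrow> 'a poly \<Rightarrow> nat" where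
  "hamming_dist c1 c2 = card {i. coeff c1 i \<noteq> coeff c2 i}"

definition min_dist :: "'a::zero poly set \<Rightarrow> nat" where
  "min_dist C = Min {hamming_dist c1 c2 | c1 c2. c1 \<in> C \<and> c2 \<in> C \<and> c1 \<noteq> c2}"

definition code_dim :: "'a::field poly set \<Rightarrow> nat" where
  "code_dim C = vector_space.dim smult C"

definition euclid_dual :: "nat \<Rightarrow> 'a::field poly set \<Rightarrow> 'a poly set" where
  "euclid_dual n C = {v \<in> words n. \<forall>c\<in>C. (\<Sum>i<n. coeff v i * coeff c i) = 0}"

end

theory Submission
  imports Defs
begin

text \<open>
  Let \<open>h\<close> be the check polynomial and \<open>g = (x ^ n + 1) / h\<close>. The roots of \<open>h\<close> are the \<open>2 m\<close>
  distinct elements \<open>\<beta> ^ (\<plusminus> 3 ^ j)\<close>, so \<open>degree h = 2 m\<close>; the code consists of the words divisible by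
  \<open>g\<close>, and its dual of those divisible by \<open>h\<close>, since the root set of \<open>h\<close> is closed under inversion.

  Both lower bounds on the distance are instances of the BCH bound with step \<open>\<beta>\<^sup>2\<close>: all
  \<open>\<beta> ^ i\<close> with \<open>i\<close> odd and \<open>(3 ^ (m - 1) - 1) / 2 < i < 3 ^ (m - 1)\<close> are roots of \<open>g\<close>, and
  \<open>\<beta> ^ (-3), \<beta> ^ (-1), \<beta>, \<beta> ^ 3\<close> are roots of \<open>h\<close>.

  There are more words of weight three than pairs \<open>(c(\<beta>), c(1/\<beta>))\<close>, so two of them differ by a
  dual codeword, of weight at most six. If \<open>4\<close> divides \<open>m\<close>, then \<open>5\<close> divides \<open>n\<close> and
  \<open>(x ^ n + 1) / (x ^ (n / 5) + 1)\<close> is a dual codeword of weight five.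
\<close>

section \<open>Supports of polynomials and the BCH bound\<close>

lemma coeff_sum_monom:
  fixes f :: "nat \<Rightarrow> 'a::comm_monoid_add"
  assumes "finite K"
  shows "coeff (\<Sum>i\<in>K. monom (f i) i) j = (if j \<in> K then f j else 0)"
  using assms by (simp add: coeff_sum coeff_monom sum.delta')

lemma finite_coeff_support: "finite {i. coeff c i \<noteq> 0}"
  by (rule finite_subset[of _ "{..degree c}"]) (auto simp: le_degree)

lemma coeff_support_word:
  assumes "c \<in> words n"
  shows "{i. coeff c i \<noteq> 0} \<subseteq> {..<n}"
  using assms le_degree[of c] by (fastforce simp: words_def)

text \<open>If the support \<open>S\<close> of \<open>c\<close> had fewer than \<open>\<delta>\<close> elements, then pairing the coefficients with the
  polynomial vanishing on all but one of the points \<open>\<gamma> ^ j\<close>, \<open>j \<in> S\<close>, would isolate a single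
  nonzero term.\<close>

lemma BCH_bound:
  fixes c :: "'a::field poly"
  assumes "c \<noteq> 0" and "b \<noteq> 0"
    and inj: "inj_on (\<lambda>j. \<gamma> ^ j) {j. coeff c j \<noteq> 0}"
    and roots: "\<And>i. i < \<delta> \<Longrightarrow> poly c (b * \<gamma> ^ i) = 0"
  shows "\<delta> < card {j. coeff c j \<noteq> 0}"
proof (rule ccontr)
  define S where "S = {j. coeff c j \<noteq> 0}"
  assume "\<not> ?thesis"
  then have card_S: "card S \<le> \<delta>" by (simp add: S_def)
  have fin: "finite S" unfolding S_def by (rule finite_coeff_support)
  from \<open>c \<noteq> 0\<close> obtain k where k: "k \<in> S"
    unfolding S_def using leading_coeff_0_iff by blast
  define P where "P = (\<Prod>j\<in>S - {k}. [:- (\<gamma> ^ j), 1:])"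
  have deg_P: "degree P < \<delta>"
  proof -
    have "degree P = card (S - {k})"
      unfolding P_def by (subst degree_prod_eq_sum_degree) auto
    also have "\<dots> < card S" using fin k by (intro psubset_card_mono) auto
    finally show ?thesis using card_S by simp
  qed
  \<comment> \<open>Evaluating \<open>c\<close> at \<open>b * \<gamma> ^ i\<close> is, after
    regrouping, the \<open>i\<close>-th power moment of the nodes \<open>\<gamma> ^ j\<close> with
    weights \<open>coeff c j * b ^ j\<close>.\<close>
  have moment: "(\<Sum>j\<in>S. coeff c j * b ^ j * (\<gamma> ^ j) ^ i) = 0" if "i < \<delta>" for i
  proof -
    have "(\<Sum>j\<in>S. coeff c j * (b * \<gamma> ^ i) ^ j) = poly c (b * \<gamma> ^ i)"
      unfolding poly_altdef S_def
      by (intro sum.mono_neutral_left) (auto simp: le_degree)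
    then show ?thesis
      using roots[OF that]
      by (simp add: power_mult_distrib mult_ac flip: power_mult)
  qed
  have "(\<Sum>j\<in>S. coeff c j * b ^ j * poly P (\<gamma> ^ j))
      = (\<Sum>i\<le>degree P. coeff P i * (\<Sum>j\<in>S. coeff c j * b ^ j * (\<gamma> ^ j) ^ i))"
    unfolding poly_altdef sum_distrib_left
    by (subst sum.swap) (simp add: mult_ac)
  also have "\<dots> = 0" using moment deg_P by (intro sum.neutral) auto
  finally have "(\<Sum>j\<in>S. coeff c j * b ^ j * poly P (\<gamma> ^ j)) = 0" .
  moreover have "(\<Sum>j\<in>S. coeff c j * b ^ j * poly P (\<gamma> ^ j)) = coeff c k * b ^ k * poly P (\<gamma> ^ k)"
  proof -
    have "poly P (\<gamma> ^ j) = 0" if "j \<in> S - {k}" for j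
      using that fin by (auto simp: P_def poly_prod)
    then show ?thesis using fin k by (subst sum.remove[of S k]) auto
  qed
  moreover have "poly P (\<gamma> ^ k) \<noteq> 0"
    using fin k inj by (auto simp: P_def poly_prod S_def inj_on_def)
  moreover have "coeff c k \<noteq> 0" using k by (simp add: S_def)
  ultimately show False using \<open>b \<noteq> 0\<close> by simp
qed

section \<open>Minimum distance as minimum weight\<close>

lemma hamming_dist_eq_weight:
  fixes c1 c2 :: "'a::ab_group_add poly"
  shows "hamming_dist c1 c2 = card {i. coeff (c1 - c2) i \<noteq> 0}"
  by (simp add: hamming_dist_def)

lemma finite_hamming_dists:
  fixes C :: "'a::field poly set"
  assumes "C \<subseteq> words n"
  shows "finite {hamming_dist c1 c2 | c1 c2. c1 \<in> C \<and> c2 \<in> C \<and> c1 \<noteq> c2}"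
proof (rule finite_subset)
  show "{hamming_dist c1 c2 | c1 c2. c1 \<in> C \<and> c2 \<in> C \<and> c1 \<noteq> c2} \<subseteq> {..n}"
  proof (clarsimp)
    fix c1 c2 assume "c1 \<in> C" "c2 \<in> C"
    then have "degree (c1 - c2) < n"
      using assms by (auto simp: words_def intro: degree_diff_less)
    then have "{i. coeff (c1 - c2) i \<noteq> 0} \<subseteq> {..<n}"
      by (intro coeff_support_word) (simp add: words_def)
    from card_mono[OF _ this] show "hamming_dist c1 c2 \<le> n"
      by (simp add: hamming_dist_eq_weight)
  qed
qed simp

lemma min_dist_le_weight:
  fixes C :: "'a::field poly set"
  assumes "C \<subseteq> words n" "0 \<in> C" "c \<in> C" "c \<noteq> 0"
  shows "min_dist C \<le> card {i. coeff c i \<noteq> 0}"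
proof -
  have "card {i. coeff c i \<noteq> 0} = hamming_dist c 0" by (simp add: hamming_dist_def)
  then show ?thesis
    unfolding min_dist_def using assms
    by (intro Min_le finite_hamming_dists[OF assms(1)]) blast
qed

text \<open>The nonzero codeword \<open>c\<close> makes the set of distances nonempty, so that
  \<open>Min\<close> is meaningful.\<close>

lemma min_dist_ge_weight:
  fixes C :: "'a::field poly set"
  assumes "C \<subseteq> words n" "0 \<in> C" "c \<in> C" "c \<noteq> 0"
    and diff: "\<And>x y. x \<in> C \<Longrightarrow> y \<in> C \<Longrightarrow> x - y \<in> C"
    and weight: "\<And>x. x \<in> C \<Longrightarrow> x \<noteq> 0 \<Longrightarrow> d \<le> card {i. coeff x i \<noteq> 0}"
  shows "d \<le> min_dist C"
  unfolding min_dist_def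
proof (subst Min_ge_iff)
  show "finite {hamming_dist c1 c2 | c1 c2. c1 \<in> C \<and> c2 \<in> C \<and> c1 \<noteq> c2}"
    by (rule finite_hamming_dists[OF assms(1)])
  show "{hamming_dist c1 c2 | c1 c2. c1 \<in> C \<and> c2 \<in> C \<and> c1 \<noteq> c2} \<noteq> {}"
    using assms(2-4) by blast
  show "\<forall>a\<in>{hamming_dist c1 c2 | c1 c2. c1 \<in> C \<and> c2 \<in> C \<and> c1 \<noteq> c2}. d \<le> a"
    unfolding hamming_dist_eq_weight using diff weight by fastforce
qed

section \<open>Dimension of the space of multiples of a polynomial\<close>

lemma vector_space_smult: "vector_space (smult :: 'a::field \<Rightarrow> 'a poly \<Rightarrow> 'a poly)"
  by standard (auto simp: smult_add_right smult_add_left)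

text \<open>The shifts \<open>g * monom 1 i\<close> with \<open>i < n - degree g\<close> form a
  basis.\<close>

lemma code_dim_multiples:
  fixes g :: "'a::field poly"
  assumes "g \<noteq> 0" "degree g \<le> n" "0 < n"
  shows "code_dim {c \<in> words n. g dvd c} = n - degree g"
proof -
  interpret V: vector_space "smult :: 'a \<Rightarrow> 'a poly \<Rightarrow> 'a poly" by (rule vector_space_smult)
  define k where "k = n - degree g"
  define e where "e i = g * monom 1 i" for i :: nat
  have e_mono: "(\<Sum>i<k. smult (u i) (e i)) = g * (\<Sum>i<k. monom (u i) i)" for u
    by (simp add: e_def sum_distrib_left smult_monom flip: mult_smult_right)
  have inj: "inj_on e {..<k}"
    using assms(1) by (auto simp: inj_on_def e_def monom_eq_iff')
  show ?thesis unfolding code_dim_def k_def[symmetric]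
  proof (rule V.dim_unique[of "e ` {..<k}"])
    show "e ` {..<k} \<subseteq> {c \<in> words n. g dvd c}"
      using assms by (auto simp: e_def words_def k_def degree_mult_eq degree_monom_eq monom_eq_0_iff)
    show "card (e ` {..<k}) = k" by (simp add: card_image inj)
    show "{c \<in> words n. g dvd c} \<subseteq> V.span (e ` {..<k})"
    proof (rule subsetI)
      fix c assume "c \<in> {c \<in> words n. g dvd c}"
      then obtain f where c: "c = g * f" and "g * f \<in> words n" by (auto simp: dvd_def)
      have "coeff f i = 0" if "i \<ge> k" for i
      proof (cases "f = 0")
        case False
        then have "degree f < k" using \<open>g * f \<in> words n\<close> assms
          by (auto simp: words_def degree_mult_eq k_def)
        then show ?thesis using that by (simp add: coeff_eq_0)
      qed simp
      then have "(\<Sum>i<k. monom (coeff f i) i) = f"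
        by (intro poly_eqI) (auto simp: coeff_sum_monom)
      then have "g * f = (\<Sum>i<k. smult (coeff f i) (e i))" by (simp add: e_mono)
      also have "\<dots> \<in> V.span (e ` {..<k})"
        by (intro V.span_sum V.span_scale V.span_base) auto
      finally show "c \<in> V.span (e ` {..<k})" unfolding c .
    qed
    show "V.independent (e ` {..<k})"
    proof (rule V.independent_if_scalars_zero)
      fix u x assume "(\<Sum>x\<in>e ` {..<k}. smult (u x) x) = 0" and x: "x \<in> e ` {..<k}"
      then have "g * (\<Sum>i<k. monom (u (e i)) i) = 0"
        using e_mono[of "u \<circ> e"] by (simp add: sum.reindex[OF inj])
      then have "(\<Sum>i<k. monom (u (e i)) i) = 0" using assms(1) by simp
      then have "coeff (\<Sum>i<k. monom (u (e i)) i) i = 0" for i by simp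
      then have "u (e i) = 0" if "i < k" for i using that coeff_sum_monom[of "{..<k}" "\<lambda>i. u (e i)" i] by simp
      then show "u x = 0" using x by auto
    qed simp
  qed
qed

section \<open>Negacyclic codes and their duals as sets of multiples\<close>

lemma degree_negacyclic_mod:
  assumes "0 < n"
  shows "degree (negacyclic_mod n :: 'a::field poly) = n"
  unfolding negacyclic_mod_def using assms
  by (subst degree_add_eq_left) (auto simp: degree_monom_eq)

text \<open>Since \<open>g\<close> divides \<open>x ^ n + 1\<close>, reduction preserves
  divisibility by \<open>g\<close>; conversely, a word is its own remainder.\<close>

lemma negacyclic_code_check_eq_multiples:
  fixes h :: "'a::field poly"
  assumes "0 < n" and gh: "g * h = negacyclic_mod n"
  shows "negacyclic_code_check n h = {c \<in> words n. g dvd c}"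
proof -
  note deg = degree_negacyclic_mod[OF assms(1), where 'a='a]
  then have N0: "negacyclic_mod n \<noteq> (0 :: 'a poly)" using assms(1) by auto
  then have "h \<noteq> 0" using gh by auto
  then have g: "negacyclic_mod n div h = g" using gh by (metis nonzero_mult_div_cancel_right)
  have "g * f mod negacyclic_mod n \<in> {c \<in> words n. g dvd c}" for f
    using degree_mod_less'[of "negacyclic_mod n" "g * f"] degree_mod_less[OF N0, of "g * f"] deg assms(1)
    by (auto simp: words_def dvd_mod gh[symmetric])
  moreover have "g * f = g * f mod negacyclic_mod n" if "g * f \<in> words n" for f
    using that deg by (simp add: words_def mod_poly_less)
  ultimately show ?thesis unfolding negacyclic_code_check_def g by blast
qed

text \<open>This is the reciprocal \<open>x ^ (n - 1) * v(1/x)\<close> taken relative to the length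
  \<open>n\<close> instead of the degree of \<open>v\<close>. It turns inner products into
  coefficients of products.\<close>

definition rev_word :: "nat \<Rightarrow> 'a::field poly \<Rightarrow> 'a poly" where
  "rev_word n v = (\<Sum>i<n. monom (coeff v (n - 1 - i)) i)"

lemma coeff_rev_word: "coeff (rev_word n v) i = (if i < n then coeff v (n - 1 - i) else 0)"
  by (simp add: rev_word_def coeff_sum_monom)

lemma degree_rev_word: "0 < n \<Longrightarrow> degree (rev_word n v) < n"
  by (intro degree_lessI) (auto simp: coeff_rev_word)

lemma coeff_mult_rev_word:
  assumes "0 < n"
  shows "coeff (c * rev_word n v) (n - 1) = (\<Sum>i<n. coeff v i * coeff c i)"
proof -
  have "coeff (c * rev_word n v) (n - 1) = (\<Sum>i\<le>n - 1. coeff c i * coeff (rev_word n v) (n - 1 - i))"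
    by (rule coeff_mult)
  also have "\<dots> = (\<Sum>i<n. coeff v i * coeff c i)"
    using assms by (intro sum.cong) (auto simp: coeff_rev_word)
  finally show ?thesis .
qed

text \<open>Products of two words have degree at most \<open>2 n - 2\<close>, so that reduction modulo \<open>x ^ n + 1\<close> leaves
  the coefficient of \<open>x ^ (n - 1)\<close> unchanged.\<close>

lemma coeff_mod_negacyclic_mod:
  fixes p :: "'a::field poly"
  assumes "degree p < 2 * n - 1"
  shows "coeff (p mod negacyclic_mod n) (n - 1) = coeff p (n - 1)"
proof -
  have "0 < n" using assms by simp
  define N :: "'a poly" where "N = negacyclic_mod n"
  define u where "u = p div N"
  have deg: "degree N = n" using \<open>0 < n\<close> unfolding N_def by (rule degree_negacyclic_mod)
  \<comment> \<open>The quotient \<open>u\<close> has degree below \<open>n - 1\<close>, so neither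
    \<open>monom 1 n * u\<close> nor \<open>u\<close> contributes at position
    \<open>n - 1\<close>.\<close>
  have "coeff u (n - 1) = 0"
  proof (cases "u = 0")
    case False
    then have "N * u \<noteq> 0" using deg \<open>0 < n\<close> by auto
    then have "n + degree u = degree (N * u)" using False deg by (simp add: degree_mult_eq)
    also have "N * u = p - p mod N" by (simp add: u_def minus_mod_eq_mult_div)
    also have "degree (p - p mod N) < 2 * n - 1"
      using assms degree_mod_less[of N p] deg \<open>0 < n\<close>
      by (intro degree_diff_less) force+
    finally show ?thesis by (intro coeff_eq_0) simp
  qed simp
  moreover have "N * u = monom 1 n * u + u" by (simp add: N_def negacyclic_mod_def algebra_simps)
  ultimately have "coeff (N * u) (n - 1) = 0"
    using \<open>0 < n\<close> by (simp add: coeff_monom_mult)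
  moreover have "p mod N = p - N * u" unfolding u_def by (simp add: minus_mult_div_eq_mod)
  ultimately show ?thesis by (simp add: N_def)
qed

text \<open>The inner product of \<open>c\<close> and \<open>v\<close> is the coefficient of
  \<open>x ^ (n - 1)\<close> in \<open>c * rev_word n v\<close> modulo \<open>x ^ n + 1\<close>. The
  multiples of \<open>g\<close> are closed under shifts, so orthogonality to all of them forces
  \<open>g * rev_word n v\<close> to vanish modulo \<open>g * h\<close>, and \<open>g\<close>
  cancels.\<close>

lemma euclid_dual_multiples:
  fixes h :: "'a::field poly"
  assumes "0 < n" and gh: "g * h = negacyclic_mod n"
  shows "euclid_dual n {c \<in> words n. g dvd c} = {v \<in> words n. h dvd rev_word n v}"
proof -
  define N :: "'a poly" where "N = negacyclic_mod n"
  have deg: "degree N = n" using assms(1) unfolding N_def by (rule degree_negacyclic_mod)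
  then have N0: "N \<noteq> 0" using assms(1) by auto
  have g0: "g \<noteq> 0" using N0 gh N_def by auto
  have coeff: "coeff (c * rev_word n v mod N) (n - 1) = (\<Sum>i<n. coeff v i * coeff c i)"
    if "c \<in> words n" for c v
  proof -
    have "degree (c * rev_word n v) < 2 * n - 1"
      using degree_mult_le[of c "rev_word n v"] degree_rev_word[OF assms(1), of v] that
      by (simp add: words_def)
    then show ?thesis
      unfolding N_def coeff_mult_rev_word[OF assms(1), symmetric] by (rule coeff_mod_negacyclic_mod)
  qed
  have "h dvd rev_word n v"
    if orth: "\<And>c. c \<in> words n \<Longrightarrow> g dvd c \<Longrightarrow> (\<Sum>i<n. coeff v i * coeff c i) = 0" for v
  proof -
    define r where "r = g * rev_word n v mod N"
    have "r = 0"
    proof (rule ccontr)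
      assume "r \<noteq> 0"
      \<comment> \<open>Multiplying by \<open>monom 1 j\<close> moves the leading term of
        \<open>r\<close> exactly to degree \<open>n - 1\<close>, without any reduction; the codeword
        \<open>c\<close> then has a nonzero inner product with \<open>v\<close>.\<close>
      define j where "j = n - 1 - degree r"
      define c where "c = g * monom 1 j mod N"
      have r: "degree r < n" using degree_mod_less'[OF N0] \<open>r \<noteq> 0\<close> deg r_def by metis
      have c: "c \<in> words n" "g dvd c"
        using degree_mod_less[OF N0, of "g * monom 1 j"] deg assms(1)
        by (auto simp: c_def words_def dvd_mod gh[symmetric] N_def)
      have "c * rev_word n v mod N = monom 1 j * r mod N"
        unfolding c_def r_def by (simp add: mod_mult_left_eq mod_mult_right_eq mult_ac)
      also have "\<dots> = monom 1 j * r"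
      proof (rule mod_poly_less)
        show "degree (monom 1 j * r) < degree N"
          using \<open>r \<noteq> 0\<close> r deg by (simp add: degree_mult_eq degree_monom_eq monom_eq_0_iff j_def)
      qed
      finally have "coeff (c * rev_word n v mod N) (n - 1) = coeff r (n - 1 - j)"
        by (simp add: coeff_monom_mult j_def)
      then have "coeff (c * rev_word n v mod N) (n - 1) = lead_coeff r"
        using r by (simp add: j_def)
      then show False using coeff[OF c(1), of v] orth[OF c] \<open>r \<noteq> 0\<close> by simp
    qed
    then have "g * h dvd g * rev_word n v" by (simp add: r_def gh N_def mod_0_imp_dvd)
    then show ?thesis using g0 by simp
  qed
  moreover have "(\<Sum>i<n. coeff v i * coeff c i) = 0"
    if "h dvd rev_word n v" "c \<in> words n" "g dvd c" for c v
  proof -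
    have "N dvd c * rev_word n v" using that by (simp add: N_def gh[symmetric] mult_dvd_mono)
    then show ?thesis using coeff[OF that(2), of v] by (simp add: mod_eq_0_iff_dvd)
  qed
  ultimately show ?thesis unfolding euclid_dual_def by blast
qed

lemma poly_rev_word:
  fixes v :: "'a::field poly"
  assumes "v \<in> words n" "x \<noteq> 0"
  shows "poly (rev_word n v) x = x ^ (n - 1) * poly v (inverse x)"
proof -
  have "poly (rev_word n v) x = (\<Sum>i<n. coeff v (n - 1 - i) * x ^ i)"
    by (simp add: rev_word_def poly_sum poly_monom)
  also have "\<dots> = (\<Sum>i<n. coeff v i * x ^ (n - 1 - i))"
    by (subst sum.nat_diff_reindex[symmetric]) (intro sum.cong, auto)
  also have "\<dots> = (\<Sum>i<n. x ^ (n - 1) * (coeff v i * inverse x ^ i))"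
  proof (intro sum.cong refl)
    fix i assume "i \<in> {..<n}"
    then have "x ^ (n - 1) = x ^ (n - 1 - i) * x ^ i" by (simp flip: power_add)
    then show "coeff v i * x ^ (n - 1 - i) = x ^ (n - 1) * (coeff v i * inverse x ^ i)"
      using assms(2) by (simp add: power_inverse)
  qed
  also have "\<dots> = x ^ (n - 1) * poly v (inverse x)"
  proof -
    have "poly v (inverse x) = (\<Sum>i<n. coeff v i * inverse x ^ i)"
      unfolding poly_altdef using assms(1)
      by (intro sum.mono_neutral_left) (auto simp: words_def coeff_eq_0)
    then show ?thesis by (simp add: sum_distrib_left)
  qed
  finally show ?thesis .
qed

section \<open>The embedding of GF(3) and the counting of ternary words\<close>

lemma emb3_inj_idom_hom:
  assumes "CHAR('b::field) = 3"
  shows "inj_idom_hom (emb3 :: gf3 \<Rightarrow> 'b)"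
proof -
  \<comment> \<open>Arithmetic on the representatives 0, 1, 2 reduces modulo 3, which is invisible
    in characteristic 3.\<close>
  have mod: "(of_int (x mod 3) :: 'b) = of_int x" for x
    unfolding of_int_eq_iff_cong_CHAR assms by (simp add: cong_def)
  have zero: "a = 0" if "(emb3 a :: 'b) = 0" for a :: gf3
  proof -
    have "3 dvd to_int_mod_ring a"
      using that unfolding emb3_def of_int_eq_0_iff_char_dvd assms by simp
    moreover have "to_int_mod_ring a \<in> {0..<3}"
      using range_to_int_mod_ring[where 'a = three] by (auto simp: card_three)
    ultimately have "to_int_mod_ring a = 0" by (simp only: atLeastLessThan_iff) presburger
    then show ?thesis by (metis to_int_mod_ring_hom.hom_zero to_int_mod_ring_hom.injectivity)
  qed
  show ?thesis
    by unfold_locales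
      (auto simp: emb3_def to_int_mod_ring_add to_int_mod_ring_mult card_three mod zero[unfolded emb3_def])
qed

lemma card_gf3: "CARD(gf3) = 3"
  by (simp add: card_three)

definition eval3 :: "gf3 poly \<Rightarrow> 'b::field \<Rightarrow> 'b" where
  "eval3 p x = poly (map_poly emb3 p) x"

lemma card_words:
  assumes "0 < k"
  shows "card (words k :: gf3 poly set) = 3 ^ k" "finite (words k :: gf3 poly set)"
proof -
  define F where "F f = (\<Sum>i<k. monom (f i) i)" for f :: "nat \<Rightarrow> gf3"
  have coeff_F: "coeff (F f) i = (if i < k then f i else 0)" for f i
    by (simp add: F_def coeff_sum_monom)
  have "inj_on F ({..<k} \<rightarrow>\<^sub>E UNIV)"
  proof (rule inj_onI)
    fix f f'
    assume f: "f \<in> {..<k} \<rightarrow>\<^sub>E UNIV" "f' \<in> {..<k} \<rightarrow>\<^sub>E UNIV" and eq: "F f = F f'"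
    show "f = f'"
    proof (rule PiE_ext[OF f])
      fix i assume "i \<in> {..<k}"
      then show "f i = f' i" using coeff_F[of f i] coeff_F[of f' i] eq by simp
    qed
  qed
  moreover have "F ` ({..<k} \<rightarrow>\<^sub>E UNIV) = words k"
  proof (intro equalityI subsetI)
    fix c assume "c \<in> F ` ({..<k} \<rightarrow>\<^sub>E UNIV)"
    then obtain f where "c = F f" by blast
    moreover have "degree (F f) < k" using assms by (intro degree_lessI) (simp_all add: coeff_F)
    ultimately show "c \<in> words k" by (simp add: words_def)
  next
    fix c :: "gf3 poly" assume "c \<in> words k"
    then have "c = F (restrict (coeff c) {..<k})"
      by (intro poly_eqI) (simp add: coeff_F words_def coeff_eq_0)
    moreover have "restrict (coeff c) {..<k} \<in> {..<k} \<rightarrow>\<^sub>E UNIV" by simp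
    ultimately show "c \<in> F ` ({..<k} \<rightarrow>\<^sub>E UNIV)" by (rule image_eqI)
  qed
  ultimately have "bij_betw F ({..<k} \<rightarrow>\<^sub>E UNIV) (words k)" by (simp add: bij_betw_def)
  from bij_betw_same_card[OF this] bij_betw_finite[OF this]
  show "card (words k :: gf3 poly set) = 3 ^ k" "finite (words k :: gf3 poly set)"
    by (simp_all add: card_PiE finite_PiE card_gf3 del: CARD_mod_ring)
qed

text \<open>A support \<open>K\<close> of size \<open>w\<close> and nonzero values on it determine a
  word. Functions are taken extensional on \<open>K\<close>, so that distinct pairs give distinct
  words.\<close>

lemma card_words_weight:
  "card {c \<in> words n. card {i. coeff (c :: gf3 poly) i \<noteq> 0} = w} \<ge> (n choose w) * 2 ^ w"
  if "0 < n"
proof -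
  define A where "A = (SIGMA K:{K. K \<subseteq> {..<n} \<and> card K = w}. K \<rightarrow>\<^sub>E (UNIV - {0 :: gf3}))"
  define F where "F = (\<lambda>(K, f :: nat \<Rightarrow> gf3). \<Sum>i\<in>K. monom (f i) i)"
  have coeff_F: "coeff (F (K, f)) i = (if i \<in> K then f i else 0)" if "(K, f) \<in> A" for K f i
    using that finite_subset[of K "{..<n}"] by (auto simp: F_def A_def coeff_sum_monom)
  have supp_F: "{i. coeff (F (K, f)) i \<noteq> 0} = K" if "(K, f) \<in> A" for K f
    using that coeff_F[OF that] by (auto simp: A_def)
  have "inj_on F A"
  proof (rule inj_onI, clarify)
    fix K f K' f' assume A: "(K, f) \<in> A" "(K', f') \<in> A" and eq: "F (K, f) = F (K', f')"
    then have K: "K = K'" using supp_F by metis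
    have "f = f'"
    proof (rule PiE_ext)
      show "f \<in> K \<rightarrow>\<^sub>E (UNIV - {0})" "f' \<in> K \<rightarrow>\<^sub>E (UNIV - {0})"
        using A K by (auto simp: A_def)
      show "f i = f' i" if "i \<in> K" for i
        using coeff_F[OF A(1), of i] coeff_F[OF A(2), of i] eq K that by simp
    qed
    with K show "K = K' \<and> f = f'" by simp
  qed
  have card_A: "card A = (n choose w) * 2 ^ w"
  proof -
    have "card A = (\<Sum>K\<in>{K. K \<subseteq> {..<n} \<and> card K = w}. card (K \<rightarrow>\<^sub>E (UNIV - {0 :: gf3})))"
      unfolding A_def using finite_subset[OF _ finite_lessThan]
      by (intro card_SigmaI ballI finite_PiE) auto
    also have "\<dots> = (\<Sum>K\<in>{K. K \<subseteq> {..<n} \<and> card K = w}. 2 ^ w)"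
    proof (intro sum.cong refl)
      fix K assume K: "K \<in> {K. K \<subseteq> {..<n} \<and> card K = w}"
      then have "finite K" by (auto intro: finite_subset)
      then show "card (K \<rightarrow>\<^sub>E (UNIV - {0 :: gf3})) = 2 ^ w"
        using K by (simp add: card_PiE card_Diff_subset card_gf3 del: CARD_mod_ring)
    qed
    finally show ?thesis by (simp add: n_subsets)
  qed
  have "F ` A \<subseteq> {c \<in> words n. card {i. coeff c i \<noteq> 0} = w}"
  proof clarify
    fix K f assume Kf: "(K, f) \<in> A"
    have "degree (F (K, f)) < n"
      using Kf \<open>0 < n\<close> by (intro degree_lessI) (auto simp: coeff_F A_def)
    then show "F (K, f) \<in> words n \<and> card {i. coeff (F (K, f)) i \<noteq> 0} = w"
      using Kf unfolding supp_F[OF Kf] by (auto simp: A_def words_def)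
  qed
  moreover have "finite {c \<in> words n. card {i. coeff (c :: gf3 poly) i \<noteq> 0} = w}"
    using card_words(2)[OF \<open>0 < n\<close>] by simp
  ultimately have "card (F ` A) \<le> card {c \<in> words n. card {i. coeff (c :: gf3 poly) i \<noteq> 0} = w}"
    by (rule card_mono[rotated])
  then show ?thesis by (simp add: card_image \<open>inj_on F A\<close> card_A)
qed

section \<open>Evaluation in characteristic 3, Frobenius and minimal polynomials\<close>

context
  assumes char3: "CHAR('b::field) = 3"
begin

interpretation emb: inj_idom_hom "emb3 :: gf3 \<Rightarrow> 'b"
  by (rule emb3_inj_idom_hom[OF char3])

interpretation mp: map_poly_inj_idom_hom "emb3 :: gf3 \<Rightarrow> 'b" ..

lemma eval3_simps:
  fixes x :: 'b
  shows "eval3 (p + q) x = eval3 p x + eval3 q x"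
    "eval3 (p - q) x = eval3 p x - eval3 q x"
    "eval3 (p * q) x = eval3 p x * eval3 q x"
    "eval3 0 x = 0" "eval3 1 x = 1" "eval3 (monom 1 k) x = x ^ k"
  by (simp_all add: eval3_def mp.hom_add mp.hom_minus mp.hom_mult poly_monom)

lemma eval3_negacyclic_mod: "eval3 (negacyclic_mod k) (x :: 'b) = x ^ k + 1"
  by (simp add: negacyclic_mod_def eval3_simps)

lemma eval3_dvd: "p dvd q \<Longrightarrow> eval3 p (x :: 'b) = 0 \<Longrightarrow> eval3 q x = 0"
  by (auto simp: dvd_def eval3_simps)

lemma eval3_rev_word:
  assumes "v \<in> words k" "(x :: 'b) \<noteq> 0"
  shows "eval3 (rev_word k v) x = x ^ (k - 1) * eval3 v (inverse x)"
proof -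
  have "map_poly emb3 (rev_word k v) = (rev_word k (map_poly emb3 v) :: 'b poly)"
    by (intro poly_eqI) (simp add: coeff_rev_word)
  moreover have "(map_poly emb3 v :: 'b poly) \<in> words k" using assms by (simp add: words_def)
  ultimately show ?thesis using assms by (simp add: eval3_def poly_rev_word)
qed

text \<open>Cubing is additive in characteristic 3 and fixes the image of GF(3), hence the
  coefficients.\<close>

lemma eval3_power_3: "eval3 p ((x :: 'b) ^ 3) = eval3 p x ^ 3"
proof -
  have fermat: "(emb3 a :: 'b) ^ 3 = emb3 a" for a
  proof -
    have "emb3 a = (of_int (to_int_mod_ring a) :: 'b)" by (simp add: emb3_def)
    moreover have "to_int_mod_ring a \<in> {0..<3}"
      using range_to_int_mod_ring[where 'a = three] by (auto simp: card_three)
    then have "to_int_mod_ring a = 0 \<or> to_int_mod_ring a = 1 \<or> to_int_mod_ring a = 2"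
      by (simp only: atLeastLessThan_iff) presburger
    moreover have "(2 :: 'b) ^ 3 = 2"
      using of_nat_eq_iff_cong_CHAR[of 8 2, where 'a = 'b] char3 by (simp add: cong_def)
    ultimately show ?thesis by auto
  qed
  have "eval3 p x ^ 3 = (\<Sum>i\<le>degree p. (emb3 (coeff p i) * x ^ i) ^ 3)"
    unfolding eval3_def poly_altdef by (subst freshmans_dream_sum) (auto simp: char3)
  also have "\<dots> = eval3 p (x ^ 3)"
    unfolding eval3_def poly_altdef
    by (simp add: power_mult_distrib fermat mult.commute flip: power_mult)
  finally show ?thesis ..
qed

lemma eval3_power_3_power: "eval3 p ((x :: 'b) ^ (3 ^ j)) = eval3 p x ^ (3 ^ j)"
proof (induction j)
  case (Suc j)
  have "eval3 p (x ^ (3 ^ Suc j)) = eval3 p ((x ^ (3 ^ j)) ^ 3)"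
    by (simp add: mult.commute flip: power_mult)
  also have "\<dots> = (eval3 p x ^ (3 ^ j)) ^ 3" by (simp add: eval3_power_3 Suc)
  finally show ?case by (simp add: mult.commute flip: power_mult)
qed simp

lemma card_eval3_roots:
  assumes "p \<noteq> 0"
  shows "finite {x :: 'b. eval3 p x = 0}" "card {x :: 'b. eval3 p x = 0} \<le> degree p"
proof -
  have "(map_poly emb3 p :: 'b poly) \<noteq> 0" using assms by simp
  from poly_roots_finite[OF this] card_poly_roots_bound[OF this]
  show "finite {x :: 'b. eval3 p x = 0}" "card {x :: 'b. eval3 p x = 0} \<le> degree p"
    by (simp_all add: eval3_def)
qed

text \<open>The polynomial \<open>p\<close> witnesses that \<open>x\<close> is algebraic, which
  makes the definite description in \<open>min_poly3\<close> denote: an annihilator of least degree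
  divides all others by division with remainder, and its monic multiple is unique.\<close>

lemma min_poly3_dvd_iff:
  assumes "p \<noteq> 0" "eval3 p (x :: 'b) = 0"
  shows "min_poly3 x dvd q \<longleftrightarrow> eval3 q x = 0"
proof -
  define P where "P r \<longleftrightarrow> monic r \<and> eval3 r x = 0 \<and> (\<forall>q. eval3 q x = 0 \<longrightarrow> r dvd q)" for r
  define k where "k = (LEAST k. \<exists>r. r \<noteq> 0 \<and> eval3 r x = 0 \<and> degree r = k)"
  have "\<exists>r. r \<noteq> 0 \<and> eval3 r x = 0 \<and> degree r = k"
    unfolding k_def by (rule LeastI_ex) (use assms in blast)
  then obtain r where r: "r \<noteq> 0" "eval3 r x = 0" "degree r = k" by blast
  have least: "k \<le> degree q" if "q \<noteq> 0" "eval3 q x = 0" for q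
    unfolding k_def using that by (intro Least_le) blast
  have dvd: "r dvd q" if "eval3 q x = 0" for q
  proof (rule ccontr)
    assume "\<not> r dvd q"
    then have "q mod r \<noteq> 0" by (simp add: mod_eq_0_iff_dvd)
    moreover have "eval3 (q mod r) x = 0"
      using that r by (simp add: eval3_simps flip: minus_mult_div_eq_mod)
    ultimately have "k \<le> degree (q mod r)" by (rule least)
    then show False using degree_mod_less'[OF r(1) \<open>q mod r \<noteq> 0\<close>] r by simp
  qed
  define s where "s = smult (inverse (lead_coeff r)) r"
  have "monic s" using r(1) by (simp add: s_def)
  moreover have "eval3 s x = 0"
    using r(2) unfolding s_def by (rule eval3_dvd[OF dvd_smult[OF dvd_refl]])
  moreover have "s dvd q" if "eval3 q x = 0" for q
    unfolding s_def using r(1) by (intro smult_dvd dvd[OF that]) simp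
  ultimately have "P s" by (simp add: P_def)
  moreover have "t = s" if "P t" for t
    using that \<open>P s\<close> unfolding P_def by (intro poly_dvd_antisym) auto
  ultimately have "P (min_poly3 x)"
    unfolding min_poly3_def P_def[symmetric] eval3_def[symmetric] by (metis theI)
  then show ?thesis unfolding P_def by (auto intro: eval3_dvd)
qed

text \<open>The BCH bound needs coefficients and roots in one field; the embedding is injective, so
  passing to the extension field keeps the support.\<close>

lemma weight_ge_of_consecutive_roots:
  assumes "c \<in> words k" "c \<noteq> 0" "(b :: 'b) \<noteq> 0"
    and "inj_on (\<lambda>j. \<gamma> ^ j) {..<k}"
    and "\<And>i. i < \<delta> \<Longrightarrow> eval3 c (b * \<gamma> ^ i) = 0"
  shows "\<delta> < card {j. coeff c j \<noteq> 0}"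
proof -
  have supp: "{j. coeff (map_poly emb3 c :: 'b poly) j \<noteq> 0} = {j. coeff c j \<noteq> 0}" by simp
  have "\<delta> < card {j. coeff (map_poly emb3 c :: 'b poly) j \<noteq> 0}"
  proof (rule BCH_bound)
    show "inj_on (\<lambda>j. \<gamma> ^ j) {j. coeff (map_poly emb3 c :: 'b poly) j \<noteq> 0}"
      unfolding supp by (rule inj_on_subset[OF assms(4) coeff_support_word[OF assms(1)]])
  qed (use assms in \<open>auto simp: eval3_def\<close>)
  then show ?thesis by (simp only: supp)
qed

end

section \<open>Powers of the root of unity \<open>\<beta>\<close>\<close>

locale negacyclic_root =
  fixes m n :: nat and \<beta> :: "'b::field"
  assumes m_ge: "4 \<le> m" and even_m: "even m"
    and n_eq: "4 * n + 1 = 3 ^ m"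
    and char3: "CHAR('b) = 3"
    and primitive: "primitive_root_of_unity (2 * n) \<beta>"
begin

lemma n_ge: "20 \<le> n"
proof -
  have "(3::nat) ^ 4 \<le> 3 ^ m" using m_ge by (intro power_increasing) auto
  then show ?thesis using n_eq by simp
qed

lemma n_pos: "0 < n" using n_ge by simp

lemma pow_2n: "\<beta> ^ (2 * n) = 1"
  and pow_neq_1: "0 < k \<Longrightarrow> k < 2 * n \<Longrightarrow> \<beta> ^ k \<noteq> 1"
  using primitive by (auto simp: primitive_root_of_unity_def)

lemma root_nonzero: "\<beta> \<noteq> 0"
  using pow_2n n_pos by (auto simp: power_0_left)

lemma pow_n: "\<beta> ^ n = -1"
proof -
  have "(\<beta> ^ n) ^ 2 = 1" using pow_2n by (simp add: mult.commute flip: power_mult)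
  moreover have "\<beta> ^ n \<noteq> 1" using n_pos by (intro pow_neq_1) auto
  ultimately show ?thesis by (simp add: power2_eq_1_iff)
qed

lemma inj_pow: "inj_on (\<lambda>i. \<beta> ^ i) {..<2 * n}"
proof -
  have "i = j" if "i \<le> j" "j < 2 * n" "\<beta> ^ i = \<beta> ^ j" for i j
  proof (rule ccontr)
    assume "i \<noteq> j"
    have "\<beta> ^ j = \<beta> ^ (j - i) * \<beta> ^ i" using that(1) by (simp flip: power_add)
    then have "\<beta> ^ (j - i) = 1" using that root_nonzero by simp
    then show False using pow_neq_1[of "j - i"] that \<open>i \<noteq> j\<close> by simp
  qed
  then show ?thesis using linorder_inj_onI'[of "{..<2 * n}"] by (metis lessThan_iff less_imp_le less_irrefl)
qed

lemma inj_pow_square: "inj_on (\<lambda>j. (\<beta> ^ 2) ^ j) {..<n}"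
proof (rule inj_onI)
  fix i j assume "i \<in> {..<n}" "j \<in> {..<n}" "(\<beta> ^ 2) ^ i = (\<beta> ^ 2) ^ j"
  then show "i = j"
    using inj_onD[OF inj_pow, of "2 * i" "2 * j"] by (simp add: power_mult)
qed

lemma inverse_pow: "k \<le> 2 * n \<Longrightarrow> inverse \<beta> ^ k = \<beta> ^ (2 * n - k)"
proof -
  assume "k \<le> 2 * n"
  then have "\<beta> ^ (2 * n - k) * \<beta> ^ k = 1" using pow_2n by (simp flip: power_add)
  then show ?thesis using root_nonzero by (simp add: power_inverse field_simps)
qed

section \<open>The check polynomial, its degree and its roots\<close>

definition check :: "gf3 poly" where
  "check = lcm (min_poly3 \<beta>) (min_poly3 (\<beta> ^ (2 * n - 1)))"

lemma eval3_negacyclic_mod_root: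
  "eval3 (negacyclic_mod n) \<beta> = 0" "eval3 (negacyclic_mod n) (inverse \<beta>) = 0"
  by (simp_all add: eval3_negacyclic_mod[OF char3] power_inverse pow_n)

lemma negacyclic_mod_nonzero: "negacyclic_mod n \<noteq> (0 :: gf3 poly)"
  using degree_negacyclic_mod[OF n_pos, where 'a = gf3] n_pos by auto

text \<open>Both \<open>\<beta>\<close> and its inverse are roots of \<open>x ^ n + 1\<close>, so
  both minimal polynomials exist, and divisibility by their lcm splits into two evaluations.\<close>

lemma check_dvd_iff: "check dvd q \<longleftrightarrow> eval3 q \<beta> = 0 \<and> eval3 q (inverse \<beta>) = 0"
proof -
  have "\<beta> ^ (2 * n - 1) = inverse \<beta>" using inverse_pow[of 1] n_pos by simp
  then show ?thesis
    unfolding check_def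
    using min_poly3_dvd_iff[OF char3 negacyclic_mod_nonzero] eval3_negacyclic_mod_root
    by (simp add: lcm_least_iff)
qed

lemma check_dvd_negacyclic_mod: "check dvd negacyclic_mod n"
  by (simp add: check_dvd_iff eval3_negacyclic_mod_root)

lemma check_nonzero: "check \<noteq> 0"
  using check_dvd_negacyclic_mod negacyclic_mod_nonzero by auto

text \<open>The pair \<open>(p(\<beta>), p(1/\<beta>))\<close> takes at most \<open>3 ^ (2 * m)\<close> values because both entries are
  roots of \<open>x ^ (3 ^ m) - x\<close>.\<close>

lemma ex_check_dvd_diff:
  assumes "3 ^ (2 * m) < card S"
  obtains p q where "p \<in> S" "q \<in> S" "p \<noteq> q" "check dvd p - q"
proof -
  define F where "F = {x :: 'b. x ^ (3 ^ m) = x}"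
  define Q :: "'b poly" where "Q = monom 1 (3 ^ m) - monom 1 1"
  have m1: "(1::nat) < 3 ^ m" using n_eq n_pos by linarith
  then have deg: "degree Q = 3 ^ m"
    unfolding Q_def diff_conv_add_uminus
    by (subst degree_add_eq_left) (auto simp: degree_monom_eq)
  then have "Q \<noteq> 0" using m1 by auto
  have F: "F = {x. poly Q x = 0}" by (simp add: F_def Q_def poly_monom)
  have "finite F" unfolding F by (rule poly_roots_finite[OF \<open>Q \<noteq> 0\<close>])
  have "card F \<le> 3 ^ m" using card_poly_roots_bound[OF \<open>Q \<noteq> 0\<close>] deg by (simp add: F)
  have fixed: "eval3 p x \<in> F" if "x ^ (3 ^ m) = x" for p x
    using eval3_power_3_power[OF char3, of p x m] that by (simp add: F_def)
  have "\<beta> ^ (3 ^ m) = \<beta>"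
  proof -
    \<comment> \<open>This uses \<open>3 ^ m = 2 * (2 * n) + 1\<close>.\<close>
    have "\<beta> ^ (3 ^ m) = (\<beta> ^ (2 * n)) ^ 2 * \<beta>"
      unfolding n_eq[symmetric] power_add power_mult[symmetric] by (simp add: mult.commute)
    then show ?thesis by (simp add: pow_2n)
  qed
  moreover from this have "inverse \<beta> ^ (3 ^ m) = inverse \<beta>" by (simp add: power_inverse)
  ultimately have sub: "(\<lambda>p. (eval3 p \<beta>, eval3 p (inverse \<beta>))) ` S \<subseteq> F \<times> F"
    using fixed by auto
  have "card ((\<lambda>p. (eval3 p \<beta>, eval3 p (inverse \<beta>))) ` S) \<le> card (F \<times> F)"
    using \<open>finite F\<close> by (intro card_mono sub) simp
  also have "\<dots> \<le> 3 ^ m * 3 ^ m"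
    unfolding card_cartesian_product using \<open>card F \<le> 3 ^ m\<close> by (intro mult_le_mono)
  also have "\<dots> < card S" using assms by (simp add: power_add[symmetric] mult_2)
  finally have "\<not> inj_on (\<lambda>p. (eval3 p \<beta>, eval3 p (inverse \<beta>))) S" by (rule pigeonhole)
  then obtain p q where "p \<in> S" "q \<in> S" "p \<noteq> q"
    "eval3 p \<beta> = eval3 q \<beta>" "eval3 p (inverse \<beta>) = eval3 q (inverse \<beta>)"
    by (auto simp: inj_on_def)
  then show ?thesis using that by (simp add: check_dvd_iff eval3_simps[OF char3])
qed

text \<open>There are \<open>3 ^ (2 * m + 1)\<close> words of length \<open>2 * m + 1\<close>, more
  than there are value pairs, so two of them differ by a nonzero multiple of
  \<open>check\<close>.\<close>

lemma degree_check_le: "degree check \<le> 2 * m"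
proof -
  have "(3::nat) ^ (2 * m) < card (words (2 * m + 1) :: gf3 poly set)" by (simp add: card_words)
  then obtain p q :: "gf3 poly" where pq: "p \<in> words (2 * m + 1)" "q \<in> words (2 * m + 1)" "p \<noteq> q"
    and dvd: "check dvd p - q"
    by (rule ex_check_dvd_diff)
  have "degree check \<le> degree (p - q)" using dvd pq(3) by (intro dvd_imp_degree_le) auto
  also have "\<dots> \<le> 2 * m" using pq by (intro degree_diff_le) (auto simp: words_def)
  finally show ?thesis .
qed

text \<open>These are the representatives below \<open>2 * n\<close> of the residues of
  \<open>3 ^ j\<close> and \<open>- (3 ^ j)\<close>, that is, the cyclotomic cosets of 1 and
  -1.\<close>

definition exponents :: "nat set" where
  "exponents = (\<lambda>j. 3 ^ j) ` {..<m} \<union> (\<lambda>j. 2 * n - 3 ^ j) ` {..<m}"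

lemma power_3_less: "j < m \<Longrightarrow> 3 ^ j < 2 * n"
proof -
  assume "j < m"
  then have "(3::nat) ^ Suc j \<le> 3 ^ m" by (intro power_increasing) auto
  then show ?thesis using n_eq n_ge by simp
qed

lemma card_exponents: "card exponents = 2 * m"
proof -
  have inj1: "inj_on (\<lambda>j. (3::nat) ^ j) {..<m}" by (auto simp: inj_on_def)
  have inj2: "inj_on (\<lambda>j. 2 * n - (3::nat) ^ j) {..<m}"
  proof (rule inj_onI)
    fix i j assume "i \<in> {..<m}" "j \<in> {..<m}" and eq: "2 * n - (3::nat) ^ i = 2 * n - 3 ^ j"
    then have "3 ^ i < 2 * n" "3 ^ j < 2 * n" using power_3_less by auto
    with eq have "(3::nat) ^ i = 3 ^ j" by linarith
    then show "i = j" by simp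
  qed
  \<comment> \<open>A collision would give \<open>2 * (3 ^ i + 3 ^ j) + 1 = 3 ^ m\<close>. If
    \<open>i\<close> and \<open>j\<close> are positive, the left side is 1 modulo 3; if one of them
    is 0, the left side is too small, as \<open>bound\<close> shows.\<close>
  have "3 ^ i \<noteq> 2 * n - 3 ^ j" if "i < m" "j < m" for i j
  proof
    assume "3 ^ i = 2 * n - 3 ^ j"
    then have eq: "2 * (3 ^ i + 3 ^ j) + 1 = (3::nat) ^ m" using power_3_less[OF that(2)] n_eq by simp
    have "(3::nat) dvd 3 ^ m" using m_ge by (simp add: dvd_power)
    have bound: "2 * (1 + 3 ^ k) + 1 \<noteq> (3::nat) ^ m" if "k < m" for k
    proof -
      have arith: "2 * (1 + x) + 1 \<noteq> z" if "x \<le> y" "z = 3 * y" "9 \<le> y" for x y z :: nat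
        using that by presburger
      have "(3::nat) ^ k \<le> 3 ^ (m - 1)" using that by (intro power_increasing) auto
      moreover have "(3::nat) ^ m = 3 * 3 ^ (m - 1)" using m_ge by (simp flip: power_Suc)
      moreover have "(3::nat) ^ 2 \<le> 3 ^ (m - 1)" using m_ge by (intro power_increasing) auto
      ultimately show ?thesis by (intro arith) simp_all
    qed
    show False
    proof (cases "i = 0 \<or> j = 0")
      case True
      then show ?thesis using bound[OF that(1)] bound[OF that(2)] eq by (auto simp: algebra_simps)
    next
      case False
      then have "(3::nat) dvd 3 ^ i" "(3::nat) dvd 3 ^ j" by (simp_all add: dvd_power)
      then show ?thesis using eq \<open>(3::nat) dvd 3 ^ m\<close> by presburger
    qed
  qed
  then have "(\<lambda>j. (3::nat) ^ j) ` {..<m} \<inter> (\<lambda>j. 2 * n - 3 ^ j) ` {..<m} = {}" by auto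
  then show ?thesis
    unfolding exponents_def by (simp add: card_Un_disjoint card_image inj1 inj2)
qed

lemma exponents_less: "exponents \<subseteq> {..<2 * n}"
  using power_3_less n_pos by (auto simp: exponents_def)

lemma eval3_check_power_3:
  "eval3 check (\<beta> ^ (3 ^ j)) = 0" "eval3 check (inverse \<beta> ^ (3 ^ j)) = 0"
  using check_dvd_iff[of check] by (simp_all add: eval3_power_3_power[OF char3])

lemma eval3_check_exponents: "e \<in> exponents \<Longrightarrow> eval3 check (\<beta> ^ e) = 0"
proof -
  assume "e \<in> exponents"
  then obtain j where "j < m" "e = 3 ^ j \<or> e = 2 * n - 3 ^ j" by (auto simp: exponents_def)
  then show ?thesis
    using eval3_check_power_3[of j] inverse_pow[of "3 ^ j"] power_3_less[of j] by auto
qed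

lemma card_pow_exponents: "card ((\<lambda>e. \<beta> ^ e) ` exponents) = 2 * m"
  using card_image[OF inj_on_subset[OF inj_pow exponents_less]] by (simp add: card_exponents)

lemma pow_exponents_subset_roots: "(\<lambda>e. \<beta> ^ e) ` exponents \<subseteq> {x. eval3 check x = 0}"
  using eval3_check_exponents by auto

text \<open>The upper bound from counting meets the lower bound from \<open>2 * m\<close> distinct
  roots.\<close>

lemma degree_check: "degree check = 2 * m"
  using degree_check_le card_mono[OF card_eval3_roots(1)[OF char3 check_nonzero] pow_exponents_subset_roots]
    card_eval3_roots(2)[OF char3 check_nonzero] card_pow_exponents by linarith

lemma roots_check: "{x. eval3 check x = 0} = (\<lambda>e. \<beta> ^ e) ` exponents"
proof -
  have "card {x :: 'b. eval3 check x = 0} \<le> card ((\<lambda>e. \<beta> ^ e) ` exponents)"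
    using card_eval3_roots(2)[OF char3 check_nonzero] by (simp add: card_pow_exponents degree_check)
  from card_seteq[OF card_eval3_roots(1)[OF char3 check_nonzero] pow_exponents_subset_roots this]
  show ?thesis by simp
qed

lemma eval3_check_nonzero:
  assumes "i < 2 * n" "i \<notin> exponents"
  shows "eval3 check (\<beta> ^ i) \<noteq> 0"
proof
  assume "eval3 check (\<beta> ^ i) = 0"
  then obtain e where "e \<in> exponents" "\<beta> ^ i = \<beta> ^ e" using roots_check by blast
  then show False using inj_onD[OF inj_pow, of i e] exponents_less assms by auto
qed

section \<open>The generator polynomial, the code and its minimum weight\<close>

definition gen :: "gf3 poly" where
  "gen = negacyclic_mod n div check"

lemma gen_mult_check: "gen * check = negacyclic_mod n"
  unfolding gen_def using check_dvd_negacyclic_mod by simp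

lemma gen_nonzero: "gen \<noteq> 0"
  using gen_mult_check negacyclic_mod_nonzero by auto

lemma degree_gen: "degree gen + 2 * m = n"
  using arg_cong[OF gen_mult_check, of degree] degree_negacyclic_mod[OF n_pos, where 'a = gf3]
  by (simp add: degree_mult_eq gen_nonzero check_nonzero degree_check)

lemma code_eq: "negacyclic_code_check n check = {c \<in> words n. gen dvd c}"
  by (rule negacyclic_code_check_eq_multiples[OF n_pos gen_mult_check])

text \<open>Reversal of a word inverts the evaluation points, and \<open>\<beta>\<close> and its
  inverse are swapped, so divisibility by \<open>check\<close> is unaffected.\<close>

lemma dual_eq: "euclid_dual n (negacyclic_code_check n check) = {v \<in> words n. check dvd v}"
proof -
  have "check dvd rev_word n v \<longleftrightarrow> check dvd v" if "v \<in> words n" for v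
    using root_nonzero
    by (auto simp: check_dvd_iff eval3_rev_word[OF char3 that])
  then show ?thesis
    unfolding code_eq euclid_dual_multiples[OF n_pos gen_mult_check] by blast
qed

text \<open>For odd \<open>i\<close>, \<open>\<beta> ^ i\<close> is a root of
  \<open>x ^ n + 1 = gen * check\<close>; if it is not a root of \<open>check\<close>, it must be
  one of \<open>gen\<close>.\<close>

lemma eval3_gen:
  assumes "odd i" "i < 2 * n" "i \<notin> exponents"
  shows "eval3 gen (\<beta> ^ i) = 0"
proof -
  have "(\<beta> ^ i) ^ n = (\<beta> ^ n) ^ i" by (simp add: mult.commute flip: power_mult)
  then have "eval3 gen (\<beta> ^ i) * eval3 check (\<beta> ^ i) = 0"
    using assms(1) unfolding eval3_simps(3)[OF char3, symmetric] gen_mult_check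
    by (simp add: eval3_negacyclic_mod[OF char3] pow_n)
  then show ?thesis using eval3_check_nonzero assms by simp
qed

text \<open>The exponents \<open>(3 ^ (m - 1) - 1) / 2 = 2 * n - 3 ^ (m - 1)\<close> and \<open>3 ^ (m - 1)\<close> of roots of
  \<open>check\<close> are neighbours: the odd numbers strictly between them are exponents of roots of \<open>gen\<close>.\<close>

lemma weight_code:
  assumes "c \<in> words n" "gen dvd c" "c \<noteq> 0"
  shows "3 ^ (m - 1) + 1 \<le> 4 * card {i. coeff c i \<noteq> 0}"
proof -
  obtain k where k: "m = 2 * k + 2"
  proof -
    obtain l where "m = 2 * l" using even_m by (rule evenE)
    then have "m = 2 * (l - 1) + 2" using m_ge by simp
    then show ?thesis by (rule that)
  qed
  \<comment> \<open>As \<open>m\<close> is even, \<open>s = 3 ^ (m - 2)\<close> is a power of 9,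
    hence 1 modulo 4. Then \<open>T = (3 ^ (m - 1) + 1) / 4\<close> is the desired bound, and
    \<open>n = 3 * T - 1\<close>.\<close>
  define s :: nat where "s = 3 ^ (2 * k)"
  have "s mod 4 = 1" unfolding s_def power_mult by (subst power_mod[symmetric]) simp
  then obtain u where u: "s = 4 * u + 1" using mult_div_mod_eq[of 4 s] by metis
  define T where "T = 3 * u + 1"
  have s: "3 * s = 4 * T - 1" "(3::nat) ^ (m - 2) = s" and T: "(3::nat) ^ (m - 1) = 4 * T - 1"
    by (simp_all add: T_def u k flip: s_def)
  have n: "n = 3 * T - 1" using n_eq by (simp add: T_def u k flip: s_def)
  \<comment> \<open>The two neighbouring exponents are \<open>2 * T - 1\<close> and
    \<open>4 * T - 1\<close>, with \<open>T - 1\<close> odd numbers strictly between them. For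
    smaller \<open>j\<close>, \<open>3 ^ j\<close> is at most \<open>s\<close>, below this range,
    and \<open>2 * n - 3 ^ j\<close> lies above it.\<close>
  have exp: "2 * T + 1 + 2 * t \<notin> exponents" if "t < T - 1" for t
  proof
    assume "2 * T + 1 + 2 * t \<in> exponents"
    then obtain j where j: "j < m"
      and or: "2 * T + 1 + 2 * t = 3 ^ j \<or> 2 * T + 1 + 2 * t = 2 * n - 3 ^ j"
      by (auto simp: exponents_def)
    show False
    proof (cases "j = m - 1")
      case True
      then show ?thesis using or that T n by auto
    next
      case False
      then have "(3::nat) ^ j \<le> 3 ^ (m - 2)" using j by (intro power_increasing) auto
      then have "(3::nat) ^ j \<le> s" using s by simp
      moreover have "x \<le> s \<Longrightarrow> \<not> (2 * T + 1 + 2 * t = x \<or> 2 * T + 1 + 2 * t = 2 * n - x)" for x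
        using that s(1) n by auto
      ultimately show ?thesis using or by blast
    qed
  qed
  have "T - 1 < card {i. coeff c i \<noteq> 0}"
  proof (rule weight_ge_of_consecutive_roots[OF char3 assms(1,3) _ inj_pow_square])
    show "\<beta> ^ (2 * T + 1) \<noteq> 0" using root_nonzero by simp
    fix t assume t: "t < T - 1"
    have "eval3 gen (\<beta> ^ (2 * T + 1 + 2 * t)) = 0"
      using t n exp[OF t] by (intro eval3_gen) auto
    then show "eval3 c (\<beta> ^ (2 * T + 1) * (\<beta> ^ 2) ^ t) = 0"
      using eval3_dvd[OF char3 assms(2)] by (simp add: power_add power_mult mult.assoc)
  qed
  then show ?thesis using T by simp
qed

section \<open>Minimum weight of the dual code\<close>

lemma weight_dual:
  assumes "v \<in> words n" "check dvd v" "v \<noteq> 0"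
  shows "5 \<le> card {i. coeff v i \<noteq> 0}"
proof -
  have "4 < card {i. coeff v i \<noteq> 0}"
  proof (rule weight_ge_of_consecutive_roots[OF char3 assms(1,3) _ inj_pow_square])
    show "inverse \<beta> ^ 3 \<noteq> 0" using root_nonzero by simp
    \<comment> \<open>Starting at exponent -3 with step 2, the four consecutive exponents -3, -1, 1,
      3 are plus or minus a power of 3.\<close>
    have "inverse \<beta> ^ 3 * (\<beta> ^ 2) ^ 0 = inverse \<beta> ^ (3 ^ 1)"
      "inverse \<beta> ^ 3 * (\<beta> ^ 2) ^ 1 = inverse \<beta> ^ (3 ^ 0)"
      "inverse \<beta> ^ 3 * (\<beta> ^ 2) ^ 2 = \<beta> ^ (3 ^ 0)"
      "inverse \<beta> ^ 3 * (\<beta> ^ 2) ^ 3 = \<beta> ^ (3 ^ 1)"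
      using root_nonzero by (simp_all add: field_simps eval_nat_numeral)
    moreover fix t :: nat assume "t < 4"
    then have "t = 0 \<or> t = 1 \<or> t = 2 \<or> t = 3" by linarith
    ultimately have "inverse \<beta> ^ 3 * (\<beta> ^ 2) ^ t
        \<in> {\<beta> ^ (3 ^ 0), \<beta> ^ (3 ^ 1), inverse \<beta> ^ (3 ^ 0), inverse \<beta> ^ (3 ^ 1)}"
      by blast
    then have "eval3 check (inverse \<beta> ^ 3 * (\<beta> ^ 2) ^ t) = 0"
      using eval3_check_power_3[of 0] eval3_check_power_3[of 1] by auto
    then show "eval3 v (inverse \<beta> ^ 3 * (\<beta> ^ 2) ^ t) = 0"
      by (rule eval3_dvd[OF char3 assms(2)])
  qed
  then show ?thesis by simp
qed

text \<open>Two words of weight three with equal values at \<open>\<beta>\<close> and its inverse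
  have a difference supported on at most six positions.\<close>

lemma ex_dual_weight_le_6:
  obtains v where "v \<in> words n" "check dvd v" "v \<noteq> 0" "card {i. coeff v i \<noteq> 0} \<le> 6"
proof -
  let ?S = "{c \<in> words n. card {i. coeff (c :: gf3 poly) i \<noteq> 0} = 3}"
  have "(3::nat) ^ (2 * m) < (n choose 3) * 2 ^ 3"
  proof -
    \<comment> \<open>The inequality is cubic against quadratic in \<open>n\<close>. After the shift
      by 20, the difference of the two sides has only positive coefficients in
      \<open>k\<close>.\<close>
    obtain k where k: "n = k + 20" using n_ge by (metis add.commute le_iff_add)
    have "6 * (n choose 3) = n * (n - 1) * (n - 2)"
    proof -
      have "6 * (n choose 3) = 2 * (n * (n - 1 choose 2))"
        using times_binomial_minus1_eq[of 3 n] by simp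
      also have "\<dots> = n * (2 * (n - 1 choose 2))" by simp
      also have "2 * (n - 1 choose 2) = (n - 1) * (n - 2)"
        using times_binomial_minus1_eq[of 2 "n - 1"] by (simp add: numeral_2_eq_2)
      finally show ?thesis by (simp add: mult.assoc)
    qed
    then have "6 * ((n choose 3) * 2 ^ 3) = 8 * (n * (n - 1) * (n - 2))" by simp
    also have "\<dots> > 6 * (4 * n + 1) ^ 2"
      unfolding k by (simp add: power2_eq_square algebra_simps)
    finally have "(4 * n + 1) ^ 2 < (n choose 3) * 2 ^ 3" by simp
    then show ?thesis unfolding n_eq by (simp add: mult.commute flip: power_mult)
  qed
  also have "\<dots> \<le> card ?S" using n_pos by (rule card_words_weight)
  finally obtain p q where pq: "p \<in> ?S" "q \<in> ?S" "p \<noteq> q" "check dvd p - q"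
    by (rule ex_check_dvd_diff)
  have "card {i. coeff (p - q) i \<noteq> 0} \<le> card ({i. coeff p i \<noteq> 0} \<union> {i. coeff q i \<noteq> 0})"
    by (intro card_mono) (auto simp: finite_coeff_support)
  also have "\<dots> \<le> 3 + 3" using card_Un_le[of "{i. coeff p i \<noteq> 0}" "{i. coeff q i \<noteq> 0}"] pq by simp
  finally have "card {i. coeff (p - q) i \<noteq> 0} \<le> 6" by simp
  moreover have "p - q \<in> words n" using pq by (auto simp: words_def intro: degree_diff_less)
  ultimately show ?thesis using that[of "p - q"] pq by simp
qed

text \<open>Since 81 is 1 modulo 5, \<open>5\<close> divides \<open>n\<close>. With
  \<open>y = x ^ (n / 5)\<close>, the quotient of \<open>y ^ 5 + 1\<close> by \<open>y + 1\<close>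
  has five terms.\<close>

lemma ex_dual_weight_le_5:
  assumes "m mod 4 = 0"
  obtains v where "v \<in> words n" "check dvd v" "v \<noteq> 0" "card {i. coeff v i \<noteq> 0} \<le> 5"
proof -
  obtain k where k: "n = 5 * k"
  proof -
    obtain l where "m = 4 * l" using assms by (auto simp: mod_eq_0_iff_dvd dvd_def)
    then have "(3::nat) ^ m mod 5 = 1" by (simp add: power_mult) (subst power_mod[symmetric], simp)
    then have "5 dvd n" unfolding n_eq[symmetric] by presburger
    then show ?thesis using that by (auto simp: dvd_def)
  qed
  then have "0 < k" using n_pos by simp
  define v :: "gf3 poly" where
    "v = 1 - monom 1 k + monom 1 (2 * k) - monom 1 (3 * k) + monom 1 (4 * k)"
  have v_mult: "v * (monom 1 k + 1) = negacyclic_mod n"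
  proof -
    have monom: "monom 1 (j * k) = (monom 1 k :: gf3 poly) ^ j" for j by (simp add: monom_power mult.commute)
    show ?thesis
      unfolding v_def k negacyclic_mod_def monom by (simp add: algebra_simps eval_nat_numeral)
  qed
  have "v \<noteq> 0" using v_mult negacyclic_mod_nonzero by auto
  have coeff_v: "coeff v i = 0" if "i \<notin> {0, k, 2 * k, 3 * k, 4 * k}" for i
    using that by (auto simp: v_def coeff_monom)
  have "v \<in> words n"
    unfolding words_def using \<open>0 < k\<close> by (auto simp: k intro!: degree_lessI coeff_v)
  moreover have "card {i. coeff v i \<noteq> 0} \<le> 5"
  proof -
    have "card {i. coeff v i \<noteq> 0} \<le> card (set [0, k, 2 * k, 3 * k, 4 * k])"
      by (intro card_mono) (use coeff_v in auto)
    also have "\<dots> \<le> 5" using card_length[of "[0, k, 2 * k, 3 * k, 4 * k]"] by simp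
    finally show ?thesis .
  qed
  moreover have "check dvd v"
  proof -
    \<comment> \<open>Otherwise \<open>\<beta>\<close> would have order at most
      \<open>2 * k < 2 * n\<close>. So the factor \<open>x ^ k + 1\<close> of
      \<open>x ^ n + 1\<close> vanishes neither at \<open>\<beta>\<close> nor at its inverse, and
      \<open>v\<close> must vanish there.\<close>
    have "\<beta> ^ k \<noteq> -1"
    proof
      assume "\<beta> ^ k = -1"
      then have "\<beta> ^ (2 * k) = 1" by (simp add: mult.commute[of 2] power_mult)
      then show False using pow_neq_1[of "2 * k"] \<open>0 < k\<close> k by simp
    qed
    then have nz: "\<beta> ^ k + 1 \<noteq> 0" "inverse \<beta> ^ k + 1 \<noteq> 0"
      by (auto simp: add_eq_0_iff2 power_inverse inverse_eq_iff_eq[of _ "-1", simplified])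
    have "eval3 v x * (x ^ k + 1) = eval3 (negacyclic_mod n) x" for x :: 'b
      unfolding v_mult[symmetric] by (simp add: eval3_simps[OF char3])
    then show ?thesis
      using eval3_negacyclic_mod_root nz by (metis check_dvd_iff mult_eq_0_iff)
  qed
  ultimately show ?thesis using that \<open>v \<noteq> 0\<close> by blast
qed

end

section \<open>The parameters of the code and of its dual\<close>

theorem theorem35:
  fixes m n :: nat and \<beta> :: "'b::field"
  assumes "m \<ge> 4" and "even m"
    and "n = (3 ^ m - 1) div 4"
    and "CHAR('b) = 3"
    and "primitive_root_of_unity (2 * n) \<beta>"
  defines "C \<equiv> negacyclic_code_check n (lcm (min_poly3 \<beta>) (min_poly3 (\<beta> ^ (2 * n - 1))))"
  shows "C \<subseteq> words n \<and> code_dim C = 2 * m \<and>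
         real (min_dist C) \<ge> (3 ^ (m - 1) + 1) / 4 \<and>
         code_dim (euclid_dual n C) = n - 2 * m \<and>
         5 \<le> min_dist (euclid_dual n C) \<and> min_dist (euclid_dual n C) \<le> 6 \<and>
         (m mod 4 = 0 \<longrightarrow> min_dist (euclid_dual n C) = 5)"
proof -
  interpret negacyclic_root m n \<beta>
  proof
    obtain k where "m = 2 * k" using \<open>even m\<close> by (rule evenE)
    \<comment> \<open>A power of 9 is 1 modulo 4, so the division defining \<open>n\<close> is
      exact.\<close>
    then have "(3::nat) ^ m mod 4 = 1" by (simp add: power_mult) (subst power_mod[symmetric], simp)
    then show "4 * n + 1 = 3 ^ m" unfolding assms(3) by presburger
  qed (use assms in auto)
  have C: "C = {c \<in> words n. gen dvd c}" unfolding C_def check_def[symmetric] by (rule code_eq)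
  have dual: "euclid_dual n C = {v \<in> words n. check dvd v}"
    unfolding C_def check_def[symmetric] by (rule dual_eq)
  have zero: "0 \<in> words n" using n_pos by (simp add: words_def)
  have diff: "x - y \<in> words n" if "x \<in> words n" "y \<in> words n" for x y :: "gf3 poly"
    using that by (auto simp: words_def intro: degree_diff_less)
  have gen: "gen \<in> words n" using degree_gen m_ge by (simp add: words_def)
  have "code_dim C = 2 * m"
    unfolding C using code_dim_multiples[OF gen_nonzero _ n_pos] degree_gen by simp
  moreover have "(3 ^ (m - 1) + 1) / 4 \<le> real (min_dist C)"
  proof -
    \<comment> \<open>The left side is the ceiling of \<open>(3 ^ (m - 1) + 1) / 4\<close>, which
      allows the weight bound to be carried as a natural number.\<close>
    have "(3 ^ (m - 1) + 4) div 4 \<le> min_dist C"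
    proof (rule min_dist_ge_weight[of C n gen])
      fix x assume "x \<in> C" "x \<noteq> 0"
      then show "(3 ^ (m - 1) + 4) div 4 \<le> card {i. coeff x i \<noteq> 0}"
        using weight_code[of x] by (simp add: C)
    qed (use zero diff gen gen_nonzero in \<open>auto simp: C\<close>)
    then have "3 ^ (m - 1) + 1 \<le> 4 * min_dist C" by linarith
    then have "real (3 ^ (m - 1) + 1) \<le> real (4 * min_dist C)" by (rule of_nat_mono)
    then show ?thesis by simp
  qed
  moreover have "code_dim (euclid_dual n C) = n - 2 * m"
    unfolding dual using code_dim_multiples[OF check_nonzero _ n_pos] degree_gen degree_check by simp
  \<comment> \<open>This word gives the upper bound 6 and is also the nonzero dual codeword required
    for the lower bound 5.\<close>
  moreover obtain v where v: "v \<in> words n" "check dvd v" "v \<noteq> 0" "card {i. coeff v i \<noteq> 0} \<le> 6"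
    by (rule ex_dual_weight_le_6)
  have le: "min_dist (euclid_dual n C) \<le> card {i. coeff v i \<noteq> 0}"
    if "v \<in> words n" "check dvd v" "v \<noteq> 0" for v
    using that zero by (intro min_dist_le_weight[of _ n]) (auto simp: dual)
  have ge: "5 \<le> min_dist (euclid_dual n C)"
    by (rule min_dist_ge_weight[of _ n v]) (use v zero diff weight_dual in \<open>auto simp: dual\<close>)
  moreover have "min_dist (euclid_dual n C) \<le> 6" using le[OF v(1-3)] v(4) by simp
  moreover have "min_dist (euclid_dual n C) = 5" if "m mod 4 = 0"
    using ex_dual_weight_le_5[OF that] le ge by (metis le_antisym le_trans)
  ultimately show ?thesis by (auto simp: C)
qed

end
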